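(* Let $\{(\Omega^{V_n},\mathbb P_n):n\in\mathbb N\}$ be a sequence of probability spaces with $V_n$ finite, where $\mathbb P_n$ is invariant under a group $\Gamma_n$ acting transitively on $V_n$, and let $f_n:\Omega^{V_n}\to\mathbb R$ be any sequence of $\Gamma_n$-invariant (square-integrable) functions. Then there is sparse reconstruction for $\{f_n\}$ if and only if there is random sparse reconstruction for $\{f_n\}$. Furthermore, the same equivalence holds between full sparse reconstruction and full random sparse reconstruction for $\{f_n\}$.
   Context: Clue: for $U\subseteq V$, $\mathsf{clue}(f\,|\,U):=\mathrm{Var}(\mathbb E[f\,|\,\mathcal F_U])/\mathrm{Var}(f)$, where $\mathcal F_U$ is generated by the coordinates in $U$ (clue $=0$ if $\mathrm{Var}(f)=0$). Sparse reconstruction for $\{f_n\}$: there are deterministic subsets $U_n\subseteq V_n$ with $|U_n|/|V_n|\to0$ and $\liminf_n\mathsf{clue}(f_n\,|\,U_n)>0$; full if $\lim_n\mathsf{clue}(f_n\,|\,U_n)=1$. Random sparse reconstruction for $\{f_n\}$: there are random subsets $\mathcal U_n\subseteq V_n$, independent of the spin system, with revealment $\max_{j\in V_n}\mathbb P[j\in\mathcal U_n]\to0$ and $\liminf_n\mathbb E[\mathsf{clue}(f_n\,|\,\mathcal U_n)]>0$; full if $\lim_n\mathbb E[\mathsf{clue}(f_n\,|\,\mathcal U_n)]=1$. *)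

theory Defs
  imports "HOL-Probability.Probability" "HOL-Algebra.Group_Action"
begin

text \<open>
  The single-spin space \<open>\<Omega>\<close> is a measurable space \<open>S\<close>. A spin system on a finite set \<open>V\<close> of
  coordinates is a probability measure \<open>M\<close> with the \<open>\<sigma>\<close>-algebra of \<open>\<Pi>\<^sub>M v\<in>V. S\<close>; it need not be
  a product measure.
\<close>

definition coord_algebra ::
  "'s measure \<Rightarrow> ('v \<Rightarrow> 's) measure \<Rightarrow> 'v set \<Rightarrow> ('v \<Rightarrow> 's) measure" where
  "coord_algebra S M U =
     sigma (space M) {(\<lambda>\<omega>. \<omega> v) -` A \<inter> space M | v A. v \<in> U \<and> A \<in> sets S}"

definition clue ::
  "'s measure \<Rightarrow> ('v \<Rightarrow> 's) measure \<Rightarrow> (('v \<Rightarrow> 's) \<Rightarrow> real) \<Rightarrow> 'v set \<Rightarrow> real" where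
  "clue S M f U =
     (if prob_space.variance M f = 0 then 0
      else prob_space.variance M (real_cond_exp M (coord_algebra S M U) f)
             / prob_space.variance M f)"

text \<open>The left action on configurations induced by an action \<open>\<phi>\<close> on coordinates:
  \<open>(g \<cdot> \<omega>) v = \<omega> (g\<inverse> \<cdot> v)\<close>.\<close>

definition config_action ::
  "('g, 'b) monoid_scheme \<Rightarrow> 'v set \<Rightarrow> ('g \<Rightarrow> 'v \<Rightarrow> 'v) \<Rightarrow> 'g \<Rightarrow> ('v \<Rightarrow> 's) \<Rightarrow> ('v \<Rightarrow> 's)" where
  "config_action G V \<phi> g \<omega> = (\<lambda>v\<in>V. \<omega> (\<phi> (inv\<^bsub>G\<^esub> g) v))"

definition invariant_measure ::
  "('g, 'b) monoid_scheme \<Rightarrow> 'v set \<Rightarrow> ('g \<Rightarrow> 'v \<Rightarrow> 'v) \<Rightarrow> ('v \<Rightarrow> 's) measure \<Rightarrow> bool" where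
  "invariant_measure G V \<phi> M \<longleftrightarrow>
     (\<forall>g\<in>carrier G. distr M M (config_action G V \<phi> g) = M)"

definition invariant_function ::
  "('g, 'b) monoid_scheme \<Rightarrow> 'v set \<Rightarrow> ('g \<Rightarrow> 'v \<Rightarrow> 'v) \<Rightarrow> ('v \<Rightarrow> 's) measure
     \<Rightarrow> (('v \<Rightarrow> 's) \<Rightarrow> real) \<Rightarrow> bool" where
  "invariant_function G V \<phi> M f \<longleftrightarrow>
     (\<forall>g\<in>carrier G. \<forall>\<omega>\<in>space M. f (config_action G V \<phi> g \<omega>) = f \<omega>)"

definition sparse_sets :: "(nat \<Rightarrow> 'v set) \<Rightarrow> (nat \<Rightarrow> 'v set) \<Rightarrow> bool" where
  "sparse_sets V U \<longleftrightarrow>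
     (\<forall>n. U n \<subseteq> V n) \<and> (\<lambda>n. real (card (U n)) / real (card (V n))) \<longlonglongrightarrow> 0"

definition sparse_reconstruction ::
  "'s measure \<Rightarrow> (nat \<Rightarrow> 'v set) \<Rightarrow> (nat \<Rightarrow> ('v \<Rightarrow> 's) measure)
     \<Rightarrow> (nat \<Rightarrow> ('v \<Rightarrow> 's) \<Rightarrow> real) \<Rightarrow> bool" where
  "sparse_reconstruction S V P f \<longleftrightarrow>
     (\<exists>U. sparse_sets V U \<and> liminf (\<lambda>n. ereal (clue S (P n) (f n) (U n))) > 0)"

definition full_sparse_reconstruction ::
  "'s measure \<Rightarrow> (nat \<Rightarrow> 'v set) \<Rightarrow> (nat \<Rightarrow> ('v \<Rightarrow> 's) measure)
     \<Rightarrow> (nat \<Rightarrow> ('v \<Rightarrow> 's) \<Rightarrow> real) \<Rightarrow> bool" where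
  "full_sparse_reconstruction S V P f \<longleftrightarrow>
     (\<exists>U. sparse_sets V U \<and> (\<lambda>n. clue S (P n) (f n) (U n)) \<longlonglongrightarrow> 1)"

text \<open>
  A random subset of \<open>V\<close> independent of the spin system \<open>M\<close> is represented by the joint law \<open>R\<close>
  of the pair (random subset, spin configuration). Independence is that of the two generated
  \<open>\<sigma>\<close>-algebras, since \<open>indep_var\<close> requires both variables to have the same type.
\<close>

definition indep_random_subset ::
  "'v set \<Rightarrow> ('v \<Rightarrow> 's) measure \<Rightarrow> ('v set \<times> ('v \<Rightarrow> 's)) measure \<Rightarrow> bool" where
  "indep_random_subset V M R \<longleftrightarrow>
     prob_space R \<and>
     sets R = sets (count_space (Pow V) \<Otimes>\<^sub>M M) \<and>
     distr R M snd = M \<and>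
     prob_space.indep_set R
       {fst -` A \<inter> space R | A. A \<in> sets (count_space (Pow V))}
       {snd -` B \<inter> space R | B. B \<in> sets M}"

definition revealment :: "'v set \<Rightarrow> ('v set \<times> ('v \<Rightarrow> 's)) measure \<Rightarrow> real" where
  "revealment V R = Max ((\<lambda>j. measure R {x \<in> space R. j \<in> fst x}) ` V)"

definition expected_clue ::
  "'s measure \<Rightarrow> ('v \<Rightarrow> 's) measure \<Rightarrow> (('v \<Rightarrow> 's) \<Rightarrow> real)
     \<Rightarrow> ('v set \<times> ('v \<Rightarrow> 's)) measure \<Rightarrow> real" where
  "expected_clue S M f R = prob_space.expectation R (\<lambda>x. clue S M f (fst x))"

definition sparse_random_sets ::
  "(nat \<Rightarrow> 'v set) \<Rightarrow> (nat \<Rightarrow> ('v \<Rightarrow> 's) measure)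
     \<Rightarrow> (nat \<Rightarrow> ('v set \<times> ('v \<Rightarrow> 's)) measure) \<Rightarrow> bool" where
  "sparse_random_sets V P R \<longleftrightarrow>
     (\<forall>n. indep_random_subset (V n) (P n) (R n)) \<and>
     (\<lambda>n. revealment (V n) (R n)) \<longlonglongrightarrow> 0"

definition random_sparse_reconstruction ::
  "'s measure \<Rightarrow> (nat \<Rightarrow> 'v set) \<Rightarrow> (nat \<Rightarrow> ('v \<Rightarrow> 's) measure)
     \<Rightarrow> (nat \<Rightarrow> ('v \<Rightarrow> 's) \<Rightarrow> real) \<Rightarrow> bool" where
  "random_sparse_reconstruction S V P f \<longleftrightarrow>
     (\<exists>R. sparse_random_sets V P R \<and>
          liminf (\<lambda>n. ereal (expected_clue S (P n) (f n) (R n))) > 0)"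

definition full_random_sparse_reconstruction ::
  "'s measure \<Rightarrow> (nat \<Rightarrow> 'v set) \<Rightarrow> (nat \<Rightarrow> ('v \<Rightarrow> 's) measure)
     \<Rightarrow> (nat \<Rightarrow> ('v \<Rightarrow> 's) \<Rightarrow> real) \<Rightarrow> bool" where
  "full_random_sparse_reconstruction S V P f \<longleftrightarrow>
     (\<exists>R. sparse_random_sets V P R \<and>
          (\<lambda>n. expected_clue S (P n) (f n) (R n)) \<longlonglongrightarrow> 1)"

end

theory Submission
  imports Defs
begin

text \<open>
  A sparse deterministic set \<open>U\<close> becomes a random one by applying a uniformly chosen element of the
  (finite) image of the group in the permutations of \<open>V\<close>: by transitivity every coordinate is
  revealed with probability \<open>|U| / |V|\<close>, and by invariance of the measure and of \<open>f\<close> all translates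
  of \<open>U\<close> have the same clue. Conversely, if \<open>\<U>\<close> has revealment \<open>\<delta>\<close> then \<open>E |\<U>| \<le> \<delta> |V|\<close>, so
  \<open>|\<U>| > \<surd>\<delta> |V|\<close> has probability at most \<open>\<surd>\<delta>\<close>; as the clue is at most 1, some set of density at
  most \<open>\<surd>\<delta>\<close> has clue at least the expected clue minus \<open>\<surd>\<delta>\<close>.
\<close>

section \<open>Coordinate sigma-algebras and bounds on the clue\<close>

lemma space_coord_algebra [simp]: "space (coord_algebra S M U) = space M"
  unfolding coord_algebra_def by (rule space_measure_of) auto

lemma sets_coord_algebra:
  "sets (coord_algebra S M U) =
     sigma_sets (space M) {(\<lambda>\<omega>. \<omega> v) -` A \<inter> space M | v A. v \<in> U \<and> A \<in> sets S}"
  unfolding coord_algebra_def by (rule sets_measure_of) auto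

lemma subalgebra_coord_algebra:
  assumes "sets M = sets (Pi\<^sub>M V (\<lambda>_. S))" and "U \<subseteq> V"
  shows "subalgebra M (coord_algebra S M U)"
proof -
  have "(\<lambda>\<omega>. \<omega> v) -` A \<inter> space M \<in> sets M" if "v \<in> U" "A \<in> sets S" for v A
  proof -
    have "(\<lambda>\<omega>. \<omega> v) \<in> measurable M S"
      using that assms by (subst measurable_cong_sets[OF assms(1) refl]) (auto intro: measurable_component_singleton)
    then show ?thesis
      using that by (auto intro: measurable_sets)
  qed
  then have "{(\<lambda>\<omega>. \<omega> v) -` A \<inter> space M | v A. v \<in> U \<and> A \<in> sets S} \<subseteq> sets M"
    by auto
  then show ?thesis
    unfolding subalgebra_def by (simp add: sets_coord_algebra sets.sigma_sets_subset)
qed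

lemma (in prob_space) variance_cong_AE:
  fixes X Y :: "'a \<Rightarrow> real"
  assumes "AE x in M. X x = Y x" "X \<in> borel_measurable M" "Y \<in> borel_measurable M"
  shows "variance X = variance Y"
proof -
  have "expectation X = expectation Y"
    using assms by (intro integral_cong_AE) auto
  then show ?thesis
    using assms by (intro integral_cong_AE) auto
qed

text \<open>Conditional Jensen for the square centred at \<open>expectation f\<close>: conditioning
  preserves the mean, so both sides integrate to variances.\<close>

lemma (in prob_space) variance_real_cond_exp_le:
  fixes f :: "'a \<Rightarrow> real"
  assumes sub: "subalgebra M F" and f: "f \<in> borel_measurable M" "integrable M (\<lambda>x. (f x)\<^sup>2)"
  shows "variance (real_cond_exp M F f) \<le> variance f"
proof -
  interpret finite_measure_subalgebra M F
    by unfold_locales (rule sub)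
  have int: "integrable M f"
    by (rule square_integrable_imp_integrable[OF f])
  define q where "q t = (t - expectation f)\<^sup>2" for t
  have "integrable M (\<lambda>x. (f x)\<^sup>2 - 2 * expectation f * f x + (expectation f)\<^sup>2)"
    using int f by auto
  then have q: "integrable M (\<lambda>x. q (f x))"
    by (simp add: q_def power2_diff algebra_simps)
  have conv: "convex_on UNIV q"
  proof (rule f''_ge0_imp_convex)
    show "(q has_real_derivative 2 * (x - expectation f)) (at x)" for x
      unfolding q_def by (auto intro!: derivative_eq_intros)
    show "((\<lambda>x. 2 * (x - expectation f)) has_real_derivative 2) (at x)" for x
      by (auto intro!: derivative_eq_intros)
  qed auto
  have meas: "q \<in> borel_measurable borel"
    unfolding q_def by measurable
  have ae: "AE x in M. q (real_cond_exp M F f x) \<le> real_cond_exp M F (\<lambda>x. q (f x)) x"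
    by (rule real_cond_exp_jensens_inequality(2)[where I = UNIV]) (use int q conv meas in auto)
  have "(\<integral>x. q (real_cond_exp M F f x) \<partial>M) \<le> (\<integral>x. real_cond_exp M F (\<lambda>x. q (f x)) x \<partial>M)"
  proof (rule integral_mono_AE)
    show int': "integrable M (\<lambda>x. real_cond_exp M F (\<lambda>x. q (f x)) x)"
      by (rule real_cond_exp_int(1)[OF q])
    \<comment> \<open>Integrability comes from the Jensen bound itself, as \<open>q\<close> is
      nonnegative.\<close>
    show "integrable M (\<lambda>x. q (real_cond_exp M F f x))"
      by (rule Bochner_Integration.integrable_bound[OF int'])
         (use ae meas in \<open>auto simp: q_def\<close>)
  qed (rule ae)
  also have "\<dots> = (\<integral>x. q (f x) \<partial>M)"
    by (rule real_cond_exp_int(2)[OF q])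
  finally show ?thesis
    using real_cond_exp_int(2)[OF int] by (simp add: q_def)
qed

lemma clue_nonneg:
  assumes "prob_space M"
  shows "0 \<le> clue S M f U"
  using assms by (auto simp: clue_def prob_space.variance_positive)

lemma clue_le_1:
  assumes "prob_space M" "sets M = sets (Pi\<^sub>M V (\<lambda>_. S))" "U \<subseteq> V"
    "f \<in> borel_measurable M" "integrable M (\<lambda>\<omega>. (f \<omega>)\<^sup>2)"
  shows "clue S M f U \<le> 1"
  using prob_space.variance_real_cond_exp_le[OF assms(1) subalgebra_coord_algebra[OF assms(2,3)] assms(4,5)]
    prob_space.variance_positive[OF assms(1), of f]
  by (auto simp: clue_def divide_le_eq_1 less_le)

text \<open>A product over no coordinates has a single configuration, so every function is constant
  and the clue takes its default value 0. Hence a nonzero clue rules out an empty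
  \<open>V n\<close>.\<close>

lemma clue_no_coordinates:
  assumes "prob_space M" "sets M = sets (Pi\<^sub>M {} (\<lambda>_. S))"
  shows "clue S M f U = 0"
proof -
  interpret prob_space M by fact
  have sp: "space M = {\<lambda>_. undefined}"
    using sets_eq_imp_space_eq[OF assms(2)] by (simp add: space_PiM)
  have "expectation f = expectation (\<lambda>_. f (\<lambda>_. undefined))"
    by (rule Bochner_Integration.integral_cong) (auto simp: sp)
  then have "variance f = expectation (\<lambda>_. 0)"
    using prob_space by (intro Bochner_Integration.integral_cong) (auto simp: sp)
  then show ?thesis
    by (simp add: clue_def)
qed

section \<open>The action on configurations and invariance of the clue under translation\<close>

context group_action
begin

lemma inv_action:
  assumes "g \<in> carrier G" "v \<in> E"
  shows "\<phi> g v \<in> E" "\<phi> (inv g) v \<in> E"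
    "\<phi> (inv g) (\<phi> g v) = v" "\<phi> g (\<phi> (inv g) v) = v"
proof -
  interpret group G using group_hom group_hom.axioms(1) by auto
  show 1: "\<phi> g v \<in> E" "\<phi> (inv g) v \<in> E"
    using assms element_image by blast+
  show "\<phi> (inv g) (\<phi> g v) = v"
    using orbit_sym_aux[OF assms] by simp
  show "\<phi> g (\<phi> (inv g) v) = v"
    using orbit_sym_aux[of "inv g" v] assms by simp
qed

text \<open>The group may be infinite, but it acts through extensional self-maps of
  \<open>E\<close>, of which there are finitely many; a uniform choice is therefore possible in the
  image.\<close>

lemma finite_image_carrier:
  assumes "finite E"
  shows "finite (\<phi> ` carrier G)"
proof (rule finite_subset)
  show "\<phi> ` carrier G \<subseteq> E \<rightarrow>\<^sub>E E"
  proof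
    fix \<sigma> assume "\<sigma> \<in> \<phi> ` carrier G"
    then have "\<sigma> \<in> Bij E"
      using bij_prop0 by blast
    then show "\<sigma> \<in> E \<rightarrow>\<^sub>E E"
      by (auto simp: Bij_def PiE_def bij_betw_def)
  qed
  show "finite (E \<rightarrow>\<^sub>E E)"
    using assms by (auto intro: finite_PiE)
qed

lemma config_action_measurable:
  assumes "sets M = sets (Pi\<^sub>M E (\<lambda>_. S))" "g \<in> carrier G"
  shows "config_action G E \<phi> g \<in> measurable M M"
  unfolding measurable_cong_sets[OF assms(1) assms(1)] config_action_def
  by (intro measurable_restrict measurable_component_singleton) (use assms inv_action in auto)

text \<open>On \<open>E\<close> the two coordinate shifts cancel; elsewhere both sides are
  \<open>undefined\<close> by extensionality.\<close>

lemma config_action_inverse: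
  assumes "sets M = sets (Pi\<^sub>M E (\<lambda>_. S))" "g \<in> carrier G" "\<omega> \<in> space M"
  shows "config_action G E \<phi> (inv g) (config_action G E \<phi> g \<omega>) = \<omega>"
proof -
  interpret group G using group_hom group_hom.axioms(1) by auto
  have "\<omega> \<in> extensional E"
    using assms(3) sets_eq_imp_space_eq[OF assms(1)] by (auto simp: space_PiM PiE_def)
  then show ?thesis
    using inv_action[OF assms(2)] assms(2)
    by (auto simp: config_action_def extensional_def fun_eq_iff)
qed

text \<open>Coordinate \<open>v\<close> of the translated configuration is coordinate
  \<open>\<phi> (inv g) v\<close> of the original one, so generators pull back to
  generators.\<close>

lemma config_action_measurable_coord_algebra:
  assumes "sets M = sets (Pi\<^sub>M E (\<lambda>_. S))" "g \<in> carrier G" "U \<subseteq> E"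
  shows "config_action G E \<phi> g \<in>
    measurable (coord_algebra S M (\<phi> (inv g) ` U)) (coord_algebra S M U)"
proof -
  let ?T = "config_action G E \<phi> g"
  have T: "?T \<in> space M \<rightarrow> space M"
    using config_action_measurable[OF assms(1,2)] by (auto simp: measurable_def)
  have "?T -` ((\<lambda>\<omega>. \<omega> v) -` A \<inter> space M) \<inter> space M
      \<in> sets (coord_algebra S M (\<phi> (inv g) ` U))" if "v \<in> U" "A \<in> sets S" for v A
  proof -
    have "?T -` ((\<lambda>\<omega>. \<omega> v) -` A \<inter> space M) \<inter> space M
        = (\<lambda>\<omega>. \<omega> (\<phi> (inv g) v)) -` A \<inter> space M"
      using T that assms by (auto simp: config_action_def)
    then show ?thesis
      using that by (auto simp: sets_coord_algebra intro!: sigma_sets.Basic)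
  qed
  then show ?thesis
    by (subst (2) coord_algebra_def) (rule measurable_measure_of, use T in auto)
qed

text \<open>The right-hand side meets the characterization of the left-hand one: it is measurable
  for the translated coordinate algebra, and invariance of \<open>M\<close> and \<open>f\<close>
  gives it the same integrals as \<open>f\<close> over the sets of that algebra.\<close>

lemma real_cond_exp_config_action:
  fixes f :: "('c \<Rightarrow> 's) \<Rightarrow> real"
  assumes M: "prob_space M" "sets M = sets (Pi\<^sub>M E (\<lambda>_. S))" and g: "g \<in> carrier G"
    and U: "U \<subseteq> E" and inv: "invariant_measure G E \<phi> M" "invariant_function G E \<phi> M f"
    and f: "integrable M f"
  shows "AE \<omega> in M. real_cond_exp M (coord_algebra S M (\<phi> (inv g) ` U)) f \<omega>
           = real_cond_exp M (coord_algebra S M U) f (config_action G E \<phi> g \<omega>)"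
proof -
  interpret group G using group_hom group_hom.axioms(1) by auto
  interpret prob_space M by fact
  let ?T = "config_action G E \<phi> g" and ?T' = "config_action G E \<phi> (inv g)"
  let ?F = "coord_algebra S M U" and ?F' = "coord_algebra S M (\<phi> (inv g) ` U)"
  let ?h = "real_cond_exp M ?F f"
  have U': "\<phi> (inv g) ` U \<subseteq> E"
    using inv_action(2)[OF g] U by blast
  interpret F: finite_measure_subalgebra M ?F
    by unfold_locales (rule subalgebra_coord_algebra[OF M(2) U])
  interpret F': finite_measure_subalgebra M ?F'
    by unfold_locales (rule subalgebra_coord_algebra[OF M(2) U'])
  have T [measurable]: "?T \<in> measurable M M"
    by (rule config_action_measurable[OF M(2) g])
  have distr: "distr M M ?T = M"
    using inv(1) g by (simp add: invariant_measure_def)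
  have f_inv: "f (?T \<omega>) = f \<omega>" if "\<omega> \<in> space M" for \<omega>
    using inv(2) g that by (simp add: invariant_function_def)
  have h: "integrable M ?h"
    by (rule F.real_cond_exp_int(1)[OF f])
  have h_meas: "?h \<in> borel_measurable ?F" by simp
  show ?thesis
  proof (rule F'.real_cond_exp_charact)
    fix A assume A: "A \<in> sets ?F'"
    \<comment> \<open>\<open>B\<close> is the image of \<open>A\<close> under \<open>?T\<close>,
      written as a preimage under the inverse action so that measurability is immediate.\<close>
    define B where "B = ?T' -` A \<inter> space M"
    \<comment> \<open>The measurability lemma at \<open>inv g\<close> has the translate by
      \<open>inv (inv g)\<close> in its source algebra; this identifies that algebra with
      \<open>?F\<close>.\<close>
    have "\<phi> (inv (inv g)) ` \<phi> (inv g) ` U = U"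
    proof -
      have "\<phi> (inv (inv g)) (\<phi> (inv g) v) = v" if "v \<in> U" for v
        using inv_action(4)[OF g, of v] that U g by auto
      then show ?thesis by (auto simp: image_iff)
    qed
    then have T': "?T' \<in> measurable ?F ?F'"
      using config_action_measurable_coord_algebra[OF M(2), of "inv g", OF _ U'] g by simp
    have B: "B \<in> sets ?F"
      using measurable_sets[OF T' A] by (simp add: B_def)
    then have BM [measurable]: "B \<in> sets M"
      using F.subalg by (auto simp: subalgebra_def)
    have AB: "\<omega> \<in> A \<longleftrightarrow> ?T \<omega> \<in> B" if "\<omega> \<in> space M" for \<omega>
      using config_action_inverse[OF M(2) g that] measurable_space[OF T that]
      by (simp add: B_def)
    \<comment> \<open>Change of variables along the measure-preserving \<open>?T\<close>, with
      \<open>A\<close> the preimage of \<open>B\<close>.\<close>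
    have transfer: "(\<integral>\<omega>\<in>A. k (?T \<omega>) \<partial>M) = (\<integral>\<omega>\<in>B. k \<omega> \<partial>M)"
      if [measurable]: "k \<in> borel_measurable M" for k :: "_ \<Rightarrow> real"
    proof -
      have "(\<integral>\<omega>\<in>B. k \<omega> \<partial>M) = (\<integral>\<omega>\<in>B. k \<omega> \<partial>distr M M ?T)"
        by (simp add: distr)
      also have "\<dots> = (\<integral>\<omega>. indicator B (?T \<omega>) *\<^sub>R k (?T \<omega>) \<partial>M)"
        unfolding set_lebesgue_integral_def by (rule integral_distr) measurable
      also have "\<dots> = (\<integral>\<omega>\<in>A. k (?T \<omega>) \<partial>M)"
        unfolding set_lebesgue_integral_def
        by (rule Bochner_Integration.integral_cong) (auto simp: AB indicator_def)
      finally show ?thesis by simp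
    qed
    have "(\<integral>\<omega>\<in>A. f \<omega> \<partial>M) = (\<integral>\<omega>\<in>A. f (?T \<omega>) \<partial>M)"
      unfolding set_lebesgue_integral_def
      by (rule Bochner_Integration.integral_cong) (auto simp: f_inv)
    also have "\<dots> = (\<integral>\<omega>\<in>B. f \<omega> \<partial>M)"
      using f by (intro transfer) auto
    also have "\<dots> = (\<integral>\<omega>\<in>B. ?h \<omega> \<partial>M)"
      by (rule F.real_cond_exp_intA[OF f B])
    also have "\<dots> = (\<integral>\<omega>\<in>A. ?h (?T \<omega>) \<partial>M)"
      using h by (intro transfer[symmetric]) auto
    finally show "(\<integral>\<omega>\<in>A. f \<omega> \<partial>M) = (\<integral>\<omega>\<in>A. ?h (?T \<omega>) \<partial>M)" .
  next
    show "integrable M (\<lambda>\<omega>. ?h (?T \<omega>))"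
      by (rule integrable_distr[OF T]) (simp add: distr h)
    show "(\<lambda>\<omega>. ?h (?T \<omega>)) \<in> borel_measurable ?F'"
      by (rule measurable_compose[OF config_action_measurable_coord_algebra[OF M(2) g U] h_meas])
  qed (rule f)
qed

text \<open>Almost surely, conditioning on the translate is conditioning on \<open>U\<close>
  followed by a measure-preserving map, which leaves the variance unchanged.\<close>

lemma clue_translate:
  fixes f :: "('c \<Rightarrow> 's) \<Rightarrow> real"
  assumes M: "prob_space M" "sets M = sets (Pi\<^sub>M E (\<lambda>_. S))" and g: "g \<in> carrier G"
    and U: "U \<subseteq> E" and inv: "invariant_measure G E \<phi> M" "invariant_function G E \<phi> M f"
    and f: "integrable M f"
  shows "clue S M f (\<phi> g ` U) = clue S M f U"
proof -
  interpret group G using group_hom group_hom.axioms(1) by auto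
  interpret prob_space M by fact
  let ?T = "config_action G E \<phi> (inv g)" and ?h = "real_cond_exp M (coord_algebra S M U) f"
  have T [measurable]: "?T \<in> measurable M M"
    by (rule config_action_measurable[OF M(2)]) (use g in simp)
  have distr: "distr M M ?T = M"
    using inv(1) g by (simp add: invariant_measure_def)
  have [measurable]: "?h \<in> borel_measurable M" by simp
  have "variance (real_cond_exp M (coord_algebra S M (\<phi> g ` U)) f) = variance (\<lambda>\<omega>. ?h (?T \<omega>))"
    using real_cond_exp_config_action[OF M _ U inv f, of "inv g"] g
    by (intro variance_cong_AE) auto
  also have "\<dots> = variance ?h"
  proof -
    \<comment> \<open>Needed twice: for the mean and for the squared deviation from it.\<close>
    have "expectation (\<lambda>\<omega>. k (?T \<omega>)) = expectation k" if "k \<in> borel_measurable M" for k :: "_ \<Rightarrow> real"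
      using integral_distr[OF T that] by (simp add: distr)
    from this[of ?h] this[of "\<lambda>\<omega>. (?h \<omega> - expectation ?h)\<^sup>2"] show ?thesis
      by simp
  qed
  finally show ?thesis
    by (simp add: clue_def)
qed

end

section \<open>Random subsets realized by product measures\<close>

text \<open>The events generated by the projections are rectangles with one full side, and the
  measure of their intersection factors. Thus any law \<open>N\<close> on subsets of
  \<open>V\<close> yields an independent random subset.\<close>

lemma indep_random_subset_pair_measure:
  assumes N: "prob_space N" "sets N = sets (count_space (Pow V))" and M: "prob_space M"
  shows "indep_random_subset V M (N \<Otimes>\<^sub>M M)"
proof -
  interpret N: prob_space N by fact
  interpret M: prob_space M by fact
  interpret R: pair_prob_space N M ..
  have times: "R.prob (A \<times> B) = N.prob A * M.prob B" if "A \<in> sets N" "B \<in> sets M" for A B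
    using M.emeasure_pair_measure_Times[OF that] by (simp add: measure_def enn2real_mult)
  have fst_eq: "fst -` A \<inter> space (N \<Otimes>\<^sub>M M) = A \<times> space M" if "A \<in> sets N" for A
    using sets.sets_into_space[OF that] by (auto simp: space_pair_measure)
  have snd_eq: "snd -` B \<inter> space (N \<Otimes>\<^sub>M M) = space N \<times> B" if "B \<in> sets M" for B
    using sets.sets_into_space[OF that] by (auto simp: space_pair_measure)
  have "distr (N \<Otimes>\<^sub>M M) M snd = M"
  proof (rule measure_eqI)
    fix B assume "B \<in> sets (distr (N \<Otimes>\<^sub>M M) M snd)"
    then have "B \<in> sets M" by simp
    then show "emeasure (distr (N \<Otimes>\<^sub>M M) M snd) B = emeasure M B"
      by (simp add: emeasure_distr snd_eq M.emeasure_pair_measure_Times N.emeasure_space_1)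
  qed simp
  moreover have "R.indep_set {fst -` A \<inter> space (N \<Otimes>\<^sub>M M) | A. A \<in> sets N}
      {snd -` B \<inter> space (N \<Otimes>\<^sub>M M) | B. B \<in> sets M}"
  proof (rule R.indep_setI)
    fix a b
    assume "a \<in> {fst -` A \<inter> space (N \<Otimes>\<^sub>M M) | A. A \<in> sets N}"
      and "b \<in> {snd -` B \<inter> space (N \<Otimes>\<^sub>M M) | B. B \<in> sets M}"
    then obtain A B where AB: "A \<in> sets N" "B \<in> sets M"
      and ab: "a = A \<times> space M" "b = space N \<times> B"
      using fst_eq snd_eq by auto
    have "a \<inter> b = A \<times> B"
      using ab sets.sets_into_space[OF AB(1)] sets.sets_into_space[OF AB(2)] by auto
    then show "R.prob (a \<inter> b) = R.prob a * R.prob b"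
      using AB by (simp add: ab times N.prob_space M.prob_space)
  qed (auto simp: measurable_sets)
  moreover have "sets (N \<Otimes>\<^sub>M M) = sets (count_space (Pow V) \<Otimes>\<^sub>M M)"
    by (rule sets_pair_measure_cong) (simp_all add: N)
  ultimately show ?thesis
    unfolding indep_random_subset_def using R.prob_space_axioms N(2) by auto
qed

lemma revealment_pair_measure:
  assumes "sets N = sets (count_space (Pow V))" and "prob_space M"
  shows "revealment V (N \<Otimes>\<^sub>M M) = Max ((\<lambda>j. measure N {A. A \<subseteq> V \<and> j \<in> A}) ` V)"
proof -
  have "measure (N \<Otimes>\<^sub>M M) {x \<in> space (N \<Otimes>\<^sub>M M). j \<in> fst x} = measure N {A. A \<subseteq> V \<and> j \<in> A}" for j
  proof -
    have sp: "space N = Pow V"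
      using sets_eq_imp_space_eq[OF assms(1)] by simp
    have "measure (distr (N \<Otimes>\<^sub>M M) N fst) {A. A \<subseteq> V \<and> j \<in> A}
        = measure (N \<Otimes>\<^sub>M M) (fst -` {A. A \<subseteq> V \<and> j \<in> A} \<inter> space (N \<Otimes>\<^sub>M M))"
      by (rule measure_distr) (auto simp: assms(1))
    also have "fst -` {A. A \<subseteq> V \<and> j \<in> A} \<inter> space (N \<Otimes>\<^sub>M M)
        = {x \<in> space (N \<Otimes>\<^sub>M M). j \<in> fst x}"
      by (auto simp: space_pair_measure sp)
    finally show ?thesis
      by (simp add: prob_space.distr_pair_fst[OF assms(2)])
  qed
  then show ?thesis
    by (simp add: revealment_def)
qed

lemma expected_clue_pair_measure:
  assumes "sets N = sets (count_space (Pow V))" and "prob_space M"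
  shows "expected_clue S M f (N \<Otimes>\<^sub>M M) = (\<integral>A. clue S M f A \<partial>N)"
proof -
  have "clue S M f \<in> borel_measurable N"
    by (subst measurable_cong_sets[OF assms(1) refl]) simp
  then have "(\<integral>A. clue S M f A \<partial>distr (N \<Otimes>\<^sub>M M) N fst) = expected_clue S M f (N \<Otimes>\<^sub>M M)"
    unfolding expected_clue_def by (intro integral_distr) auto
  then show ?thesis
    by (simp add: prob_space.distr_pair_fst[OF assms(2)])
qed

section \<open>From a deterministic set to its random translate\<close>

context transitive_action
begin

text \<open>The fibres \<open>?K u\<close> are disjoint for distinct \<open>u\<close> in
  \<open>E\<close>, and transitivity makes them equally large: precomposing with an element that
  moves \<open>u'\<close> to \<open>u\<close> injects \<open>?K u\<close> into \<open>?K u'\<close>.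
  Counting over \<open>U\<close> and over all of \<open>E\<close> gives the ratio.\<close>

lemma card_translates_containing:
  assumes fin: "finite E" and U: "U \<subseteq> E" and j: "j \<in> E"
  shows "card {\<sigma> \<in> \<phi> ` carrier G. j \<in> \<sigma> ` U} * card E = card (\<phi> ` carrier G) * card U"
proof -
  interpret group G using group_hom group_hom.axioms(1) by auto
  let ?H = "\<phi> ` carrier G"
  let ?K = "\<lambda>u. {\<sigma> \<in> ?H. \<sigma> u = j}"
  have ext: "\<sigma> \<in> extensional E" and bij: "bij_betw \<sigma> E E" if "\<sigma> \<in> ?H" for \<sigma>
    using that bij_prop0 by (auto simp: Bij_def)
  have finH: "finite ?H"
    by (rule finite_image_carrier[OF fin])
  have le: "card (?K u) \<le> card (?K u')" if u: "u \<in> E" "u' \<in> E" for u u'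
  proof -
    obtain g where g: "g \<in> carrier G" "\<phi> g u' = u"
      using unique_orbit u by blast
    have "compose E \<sigma> (\<phi> g) \<in> ?K u'" if "\<sigma> \<in> ?K u" for \<sigma>
    proof -
      from that obtain h where h: "h \<in> carrier G" "\<sigma> = \<phi> h" "\<sigma> u = j" by auto
      \<comment> \<open>Since \<open>compose\<close> is extensional on \<open>E\<close>, the
        composite is literally the image of the product, hence lies in \<open>?H\<close>.\<close>
      have "compose E \<sigma> (\<phi> g) = \<phi> (h \<otimes> g)"
        using h g ext[of "\<phi> (h \<otimes> g)"]
        by (intro extensionalityI[of _ E]) (auto simp: compose_def composition_rule)
      then show ?thesis
        using h g u composition_rule[of u' h g] by (auto simp: compose_def)
    qed
    \<comment> \<open>Right cancellation, because \<open>\<phi> g\<close> is onto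
      \<open>E\<close>.\<close>
    moreover have "inj_on (\<lambda>\<sigma>. compose E \<sigma> (\<phi> g)) (?K u)"
    proof (rule inj_onI)
      fix \<sigma> \<tau> assume st: "\<sigma> \<in> ?K u" "\<tau> \<in> ?K u" "compose E \<sigma> (\<phi> g) = compose E \<tau> (\<phi> g)"
      show "\<sigma> = \<tau>"
      proof (rule extensionalityI[of _ E])
        fix x assume "x \<in> E"
        then obtain y where "y \<in> E" "x = \<phi> g y"
          using surj_prop[OF g(1)] by blast
        then show "\<sigma> x = \<tau> x"
          using st(3) by (auto simp: compose_def fun_eq_iff dest: spec[of _ y])
      qed (use st ext in auto)
    qed
    ultimately show ?thesis
      using finH by (intro card_inj_on_le) auto
  qed
  have card_eq: "card {\<sigma> \<in> ?H. j \<in> \<sigma> ` W} = card W * card (?K j)" if W: "W \<subseteq> E" for W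
  proof -
    have "{\<sigma> \<in> ?H. j \<in> \<sigma> ` W} = (\<Union>u\<in>W. ?K u)" by auto
    also have "card \<dots> = (\<Sum>u\<in>W. card (?K u))"
    proof (rule card_UN_disjoint)
      show "\<forall>u\<in>W. \<forall>v\<in>W. u \<noteq> v \<longrightarrow> ?K u \<inter> ?K v = {}"
        using W bij unfolding bij_betw_def inj_on_def by blast
    qed (use finH W fin finite_subset in auto)
    also have "\<dots> = (\<Sum>u\<in>W. card (?K j))"
      using W j le by (intro sum.cong refl antisym) auto
    finally show ?thesis by simp
  qed
  \<comment> \<open>Every permutation of \<open>E\<close> hits \<open>j\<close>, so the case
    \<open>W = E\<close> determines the common fibre size.\<close>
  have "{\<sigma> \<in> ?H. j \<in> \<sigma> ` E} = ?H"
    using bij j by (auto simp: bij_betw_def)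
  then have "card ?H = card E * card (?K j)"
    using card_eq[of E] by simp
  then show ?thesis
    using card_eq[OF U] by simp
qed

text \<open>On the empty set of coordinates the revealment is the junk value \<open>Max {}\<close>.\<close>

lemma ex_random_translate:
  fixes f :: "('c \<Rightarrow> 's) \<Rightarrow> real"
  assumes M: "prob_space M" "sets M = sets (Pi\<^sub>M E (\<lambda>_. S))" and fin: "finite E"
    and U: "U \<subseteq> E" and inv: "invariant_measure G E \<phi> M" "invariant_function G E \<phi> M f"
    and f: "integrable M f"
  shows "\<exists>R. indep_random_subset E M R
    \<and> (E \<noteq> {} \<longrightarrow> revealment E R = real (card U) / real (card E))
    \<and> expected_clue S M f R = clue S M f U"
proof -
  interpret group G using group_hom group_hom.axioms(1) by auto
  let ?H = "\<phi> ` carrier G"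
  \<comment> \<open>The law of the translate of \<open>U\<close> by a uniform element of
    \<open>?H\<close>.\<close>
  define N where "N = distr (uniform_count_measure ?H) (count_space (Pow E)) (\<lambda>\<sigma>. \<sigma> ` U)"
  have finH: "finite ?H"
    by (rule finite_image_carrier[OF fin])
  have H0: "?H \<noteq> {}" by blast
  have sub: "\<sigma> ` U \<subseteq> E" if "\<sigma> \<in> ?H" for \<sigma>
    using that U surj_prop by blast
  have meas: "(\<lambda>\<sigma>. \<sigma> ` U) \<in> measurable (uniform_count_measure ?H) (count_space (Pow E))"
    using sub by (auto simp: measurable_def space_uniform_count_measure sets_uniform_count_measure)
  have sets_N: "sets N = sets (count_space (Pow E))"
    by (simp add: N_def)
  have prob_N: "prob_space N"
    unfolding N_def
    by (rule prob_space.prob_space_distr[OF prob_space_uniform_count_measure[OF finH H0] meas])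
  have "measure N {A. A \<subseteq> E \<and> j \<in> A} = real (card U) / real (card E)" if j: "j \<in> E" for j
  proof -
    have "measure N {A. A \<subseteq> E \<and> j \<in> A}
        = measure (uniform_count_measure ?H) {\<sigma> \<in> ?H. j \<in> \<sigma> ` U}"
    proof -
      have "(\<lambda>\<sigma>. \<sigma> ` U) -` {A. A \<subseteq> E \<and> j \<in> A} \<inter> space (uniform_count_measure ?H)
          = {\<sigma> \<in> ?H. j \<in> \<sigma> ` U}"
        using sub unfolding space_uniform_count_measure by blast
      then show ?thesis
        unfolding N_def by (subst measure_distr[OF meas]) auto
    qed
    also have "\<dots> = real (card {\<sigma> \<in> ?H. j \<in> \<sigma> ` U}) / real (card ?H)"
      by (rule measure_uniform_count_measure[OF finH]) auto
    also have "\<dots> = real (card U) / real (card E)"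
    proof -
      have "card E > 0" "card ?H > 0"
        using j fin finH H0 by (auto simp: card_gt_0_iff)
      then show ?thesis
        using arg_cong[OF card_translates_containing[OF fin U j], of real]
        by (simp add: field_simps)
    qed
    finally show ?thesis .
  qed
  then have "revealment E (N \<Otimes>\<^sub>M M) = real (card U) / real (card E)" if "E \<noteq> {}"
    using that by (simp add: revealment_pair_measure[OF sets_N M(1)] image_constant_conv)
  moreover have "expected_clue S M f (N \<Otimes>\<^sub>M M) = clue S M f U"
  proof -
    have "expected_clue S M f (N \<Otimes>\<^sub>M M)
        = (\<integral>\<sigma>. clue S M f (\<sigma> ` U) \<partial>uniform_count_measure ?H)"
      unfolding expected_clue_pair_measure[OF sets_N M(1)] unfolding N_def
      by (rule integral_distr[OF meas, where f = "clue S M f"]) simp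
    also have "\<dots> = (\<Sum>\<sigma>\<in>?H. clue S M f (\<sigma> ` U)) / card ?H"
      by (rule integral_uniform_count_measure[OF finH])
    also have "(\<Sum>\<sigma>\<in>?H. clue S M f (\<sigma> ` U)) = (\<Sum>\<sigma>\<in>?H. clue S M f U)"
      using clue_translate[OF M _ U inv f] by (intro sum.cong) auto
    finally show ?thesis
      using finH H0 by simp
  qed
  ultimately show ?thesis
    using indep_random_subset_pair_measure[OF prob_N sets_N M(1)] by blast
qed

end

section \<open>From a random subset to a deterministic one\<close>

text \<open>The parameter \<open>s\<close> serves twice, as density threshold and as bound on the
  probability of exceeding it: Markov's inequality divides the mean density, at most
  \<open>s\<^sup>2\<close>, by \<open>s\<close>.\<close>

lemma ex_small_set_large_clue:
  assumes M: "prob_space M" "sets M = sets (Pi\<^sub>M V (\<lambda>_. S))" and fin: "finite V"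
    and f: "f \<in> borel_measurable M" "integrable M (\<lambda>\<omega>. (f \<omega>)\<^sup>2)"
    and R: "indep_random_subset V M R" and s: "0 < s" "revealment V R \<le> s\<^sup>2"
  shows "\<exists>U\<subseteq>V. real (card U) \<le> s * real (card V) \<and> expected_clue S M f R \<le> clue S M f U + s"
proof -
  interpret R: prob_space R using R by (simp add: indep_random_subset_def)
  have sets_R: "sets R = sets (count_space (Pow V) \<Otimes>\<^sub>M M)"
    using R by (simp add: indep_random_subset_def)
  have space_R: "fst x \<subseteq> V" if "x \<in> space R" for x
    using that sets_eq_imp_space_eq[OF sets_R] by (auto simp: space_pair_measure)
  have fst_meas: "fst \<in> measurable R (count_space (Pow V))"
    by (subst measurable_cong_sets[OF sets_R refl]) simp
  have meas: "(\<lambda>x. k (fst x)) \<in> borel_measurable R" for k :: "_ \<Rightarrow> real"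
    by (rule measurable_compose[OF fst_meas]) simp
  have event: "{x \<in> space R. Q (fst x)} \<in> R.events" for Q
  proof -
    have "{x \<in> space R. Q (fst x)} = fst -` {A \<in> Pow V. Q A} \<inter> space R"
      using space_R by auto
    then show ?thesis
      using measurable_sets[OF fst_meas, of "{A \<in> Pow V. Q A}"] by auto
  qed
  have event_int: "integrable R (indicator {x \<in> space R. Q (fst x)} :: _ \<Rightarrow> real)" for Q
    using event[of Q] by (simp add: R.emeasure_finite less_top[symmetric])
  define c where "c = clue S M f"
  have c_bounds: "0 \<le> c U" "U \<subseteq> V \<Longrightarrow> c U \<le> 1" for U
    unfolding c_def using clue_nonneg[OF M(1)] clue_le_1[OF M _ f] by auto
  \<comment> \<open>Among the finitely many sets below the threshold, the empty one included, a set
    of maximal clue is taken.\<close>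
  let ?C = "{U \<in> Pow V. real (card U) \<le> s * real (card V)}"
  have "finite (c ` ?C)" "c ` ?C \<noteq> {}"
    using fin s by (auto intro!: exI[of _ "{}"])
  then have "Max (c ` ?C) \<in> c ` ?C"
    by (rule Max_in)
  then obtain U where U: "U \<subseteq> V" "real (card U) \<le> s * real (card V)" and "c U = Max (c ` ?C)"
    by auto
  then have max: "c W \<le> c U" if "W \<subseteq> V" "real (card W) \<le> s * real (card V)" for W
    using \<open>finite (c ` ?C)\<close> that by auto
  define B where "B = {x \<in> space R. s * real (card V) < real (card (fst x))}"
  have B [measurable]: "B \<in> R.events"
    unfolding B_def by (rule event)
  have B_int: "integrable R (indicator B :: _ \<Rightarrow> real)"
    unfolding B_def by (rule event_int)
  \<comment> \<open>Off \<open>B\<close> the random subset competes in the maximum; on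
    \<open>B\<close> the indicator alone covers its clue, which is at most 1.\<close>
  have "R.expectation (\<lambda>x. c (fst x)) \<le> R.expectation (\<lambda>x. c U + indicator B x)"
  proof (rule integral_mono)
    show "integrable R (\<lambda>x. c (fst x))"
      by (rule R.integrable_const_bound[of _ 1]) (use c_bounds space_R meas in auto)
    show "c (fst x) \<le> c U + indicator B x" if "x \<in> space R" for x
      using max[OF space_R[OF that]] c_bounds(2)[OF space_R[OF that]] c_bounds(1)[of U] that
      by (auto simp: B_def indicator_def)
  qed (use B_int in simp)
  also have "\<dots> = c U + R.prob B"
    using B_int by (simp add: R.prob_space)
  also have "R.prob B \<le> s"
  \<comment> \<open>With no coordinates the revealment is \<open>Max {}\<close> and carries no
    information, but then \<open>B\<close> is empty.\<close>
  proof (cases "V = {}")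
    case True
    then have "B = {}"
      using space_R by (fastforce simp: B_def)
    then show ?thesis using s by simp
  next
    case False
    have ind: "real (card (fst x)) = (\<Sum>j\<in>V. indicator {x \<in> space R. j \<in> fst x} x)"
      if "x \<in> space R" for x
    proof -
      have "V \<inter> {j. j \<in> fst x} = fst x" using space_R[OF that] by auto
      then show ?thesis
        using that fin by (simp add: indicator_def sum.If_cases)
    qed
    \<comment> \<open>Markov's inequality for the cardinality, whose mean is the sum of the
      inclusion probabilities.\<close>
    have "s * real (card V) * R.prob B = R.expectation (\<lambda>x. s * real (card V) * indicator B x)"
      by simp
    also have "\<dots> \<le> R.expectation (\<lambda>x. \<Sum>j\<in>V. indicator {x \<in> space R. j \<in> fst x} x)"
    proof (rule integral_mono)
      show "s * real (card V) * indicator B x \<le> (\<Sum>j\<in>V. indicator {x \<in> space R. j \<in> fst x} x)"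
        if "x \<in> space R" for x
        unfolding ind[OF that, symmetric] by (auto simp: B_def indicator_def)
    qed (use B_int in \<open>auto intro!: Bochner_Integration.integrable_sum event_int\<close>)
    also have "\<dots> = (\<Sum>j\<in>V. R.prob {x \<in> space R. j \<in> fst x})"
      using event by (subst Bochner_Integration.integral_sum) (auto intro: event_int)
    also have "\<dots> \<le> (\<Sum>j\<in>V. s\<^sup>2)"
    proof (rule sum_mono)
      fix j assume "j \<in> V"
      then have "R.prob {x \<in> space R. j \<in> fst x} \<le> revealment V R"
        unfolding revealment_def using fin by (intro Max_ge) auto
      then show "R.prob {x \<in> space R. j \<in> fst x} \<le> s\<^sup>2"
        using s by simp
    qed
    finally have "(s * real (card V)) * R.prob B \<le> (s * real (card V)) * s"
      by (simp add: power2_eq_square algebra_simps)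
    then show ?thesis
      using False fin s by (simp add: card_gt_0_iff)
  qed
  finally show ?thesis
    using U unfolding expected_clue_def c_def by auto
qed

section \<open>Asymptotics and the two equivalences\<close>

text \<open>Turns the liminf condition into an eventual lower bound, which survives subtracting a
  null sequence.\<close>

lemma liminf_ereal_pos_iff:
  fixes a :: "nat \<Rightarrow> real"
  shows "liminf (\<lambda>n. ereal (a n)) > 0 \<longleftrightarrow> (\<exists>c>0. eventually (\<lambda>n. c \<le> a n) sequentially)"
proof
  assume "liminf (\<lambda>n. ereal (a n)) > 0"
  then obtain c where c: "0 < ereal c" "ereal c < liminf (\<lambda>n. ereal (a n))"
    using ereal_dense2 by blast
  then have "eventually (\<lambda>n. ereal c < ereal (a n)) sequentially"
    by (intro less_LiminfD)
  then show "\<exists>c>0. eventually (\<lambda>n. c \<le> a n) sequentially"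
    using c(1) by (intro exI[of _ c]) (auto elim: eventually_mono)
next
  assume "\<exists>c>0. eventually (\<lambda>n. c \<le> a n) sequentially"
  then obtain c where c: "0 < c" "eventually (\<lambda>n. c \<le> a n) sequentially" by auto
  then have "ereal c \<le> liminf (\<lambda>n. ereal (a n))"
    by (intro Liminf_bounded) (auto elim: eventually_mono)
  then show "liminf (\<lambda>n. ereal (a n)) > 0"
    using c(1) by (metis ereal_less(2) less_le_trans)
qed

theorem lemma1p3:
  fixes S :: "'s measure"
    and V :: "nat \<Rightarrow> 'v set"
    and P :: "nat \<Rightarrow> ('v \<Rightarrow> 's) measure"
    and G :: "nat \<Rightarrow> ('g, 'b) monoid_scheme"
    and \<phi> :: "nat \<Rightarrow> 'g \<Rightarrow> 'v \<Rightarrow> 'v"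
    and f :: "nat \<Rightarrow> ('v \<Rightarrow> 's) \<Rightarrow> real"
  assumes finite_V: "\<And>n. finite (V n)"
    and sets_P: "\<And>n. sets (P n) = sets (Pi\<^sub>M (V n) (\<lambda>_. S))"
    and prob_P: "\<And>n. prob_space (P n)"
    and transitive: "\<And>n. transitive_action (G n) (V n) (\<phi> n)"
    and P_invariant: "\<And>n. invariant_measure (G n) (V n) (\<phi> n) (P n)"
    and f_measurable: "\<And>n. f n \<in> borel_measurable (P n)"
    and f_square_integrable: "\<And>n. integrable (P n) (\<lambda>\<omega>. (f n \<omega>)\<^sup>2)"
    and f_invariant: "\<And>n. invariant_function (G n) (V n) (\<phi> n) (P n) (f n)"
  shows "(sparse_reconstruction S V P f \<longleftrightarrow> random_sparse_reconstruction S V P f) \<and>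
         (full_sparse_reconstruction S V P f \<longleftrightarrow> full_random_sparse_reconstruction S V P f)"
proof -
  have f_int: "integrable (P n) (f n)" for n
    using finite_measure.square_integrable_imp_integrable[OF prob_space.finite_measure[OF prob_P]
        f_measurable f_square_integrable] .
  have clue_le: "clue S (P n) (f n) U \<le> 1" if "U \<subseteq> V n" for n U
    by (rule clue_le_1[OF prob_P sets_P that f_measurable f_square_integrable])
  have nonempty: "V n \<noteq> {}" if "clue S (P n) (f n) U \<noteq> 0" for n U
    using that clue_no_coordinates[OF prob_P[of n], of S "f n" U] sets_P[of n] by auto
  \<comment> \<open>An eventually nonzero clue forces \<open>V n\<close> to be eventually nonempty,
    where the revealment is the density of \<open>U n\<close>. Both notions of sparse reconstruction
    supply this hypothesis.\<close>
  have random: "\<exists>R. sparse_random_sets V P R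
      \<and> (\<forall>n. expected_clue S (P n) (f n) (R n) = clue S (P n) (f n) (U n))"
    if U: "sparse_sets V U" and ev: "eventually (\<lambda>n. clue S (P n) (f n) (U n) \<noteq> 0) sequentially"
    for U
  proof -
    have "\<forall>n. \<exists>R. indep_random_subset (V n) (P n) R
        \<and> (V n \<noteq> {} \<longrightarrow> revealment (V n) R = real (card (U n)) / real (card (V n)))
        \<and> expected_clue S (P n) (f n) R = clue S (P n) (f n) (U n)"
      using U transitive_action.ex_random_translate[OF transitive prob_P sets_P finite_V _
          P_invariant f_invariant f_int]
      by (auto simp: sparse_sets_def)
    then obtain R where R: "\<And>n. indep_random_subset (V n) (P n) (R n)"
      "\<And>n. V n \<noteq> {} \<Longrightarrow> revealment (V n) (R n) = real (card (U n)) / real (card (V n))"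
      "\<And>n. expected_clue S (P n) (f n) (R n) = clue S (P n) (f n) (U n)"
      by (auto dest!: choice)
    have "(\<lambda>n. revealment (V n) (R n)) \<longlonglongrightarrow> 0"
    proof (rule Lim_transform_eventually)
      show "(\<lambda>n. real (card (U n)) / real (card (V n))) \<longlonglongrightarrow> 0"
        using U by (simp add: sparse_sets_def)
      show "\<forall>\<^sub>F n in sequentially. real (card (U n)) / real (card (V n)) = revealment (V n) (R n)"
        using ev by (rule eventually_mono) (use R(2) nonempty in simp)
    qed
    then show ?thesis
      using R by (auto simp: sparse_random_sets_def)
  qed
  have deterministic: "\<exists>U s. sparse_sets V U \<and> s \<longlonglongrightarrow> 0
      \<and> (\<forall>n. expected_clue S (P n) (f n) (R n) \<le> clue S (P n) (f n) (U n) + s n)"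
    if R: "sparse_random_sets V P R" for R
  proof -
    \<comment> \<open>The summand \<open>1 / (n + 1)\<close> keeps \<open>s n\<close> positive when the revealment vanishes.\<close>
    define s where "s n = sqrt \<bar>revealment (V n) (R n)\<bar> + 1 / real (Suc n)" for n
    have "(\<lambda>n. revealment (V n) (R n)) \<longlonglongrightarrow> 0"
      using R by (simp add: sparse_random_sets_def)
    then have "(\<lambda>n. sqrt \<bar>revealment (V n) (R n)\<bar>) \<longlonglongrightarrow> 0"
      using tendsto_real_sqrt[OF tendsto_rabs_zero] by fastforce
    then have s_lim: "s \<longlonglongrightarrow> 0"
      using tendsto_add[OF _ LIMSEQ_Suc[OF lim_1_over_n]] unfolding s_def by fastforce
    have s_pos: "0 < s n" for n
      unfolding s_def by (intro add_nonneg_pos) auto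
    \<comment> \<open>The absolute value in \<open>s\<close> covers empty \<open>V n\<close>, where
      the sign of the revealment is unknown.\<close>
    have "revealment (V n) (R n) \<le> (s n)\<^sup>2" for n
    proof -
      have "revealment (V n) (R n) \<le> (sqrt \<bar>revealment (V n) (R n)\<bar>)\<^sup>2" by simp
      also have "\<dots> \<le> (s n)\<^sup>2"
        unfolding s_def by (intro power_mono) auto
      finally show ?thesis .
    qed
    then have "\<forall>n. \<exists>U. U \<subseteq> V n \<and> real (card U) \<le> s n * real (card (V n))
        \<and> expected_clue S (P n) (f n) (R n) \<le> clue S (P n) (f n) U + s n"
      using R s_pos ex_small_set_large_clue[OF prob_P sets_P finite_V f_measurable f_square_integrable]
      by (auto simp: sparse_random_sets_def)
    then obtain U where U: "\<And>n. U n \<subseteq> V n" "\<And>n. real (card (U n)) \<le> s n * real (card (V n))"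
      "\<And>n. expected_clue S (P n) (f n) (R n) \<le> clue S (P n) (f n) (U n) + s n"
      by (auto dest!: choice)
    \<comment> \<open>For empty \<open>V n\<close> the quotient is 0 by the convention for division
      by zero.\<close>
    have "real (card (U n)) / real (card (V n)) \<le> s n" for n
      using U(2)[of n] s_pos[of n] by (cases "card (V n) = 0") (auto simp: divide_le_eq)
    then have "(\<lambda>n. real (card (U n)) / real (card (V n))) \<longlonglongrightarrow> 0"
      by (intro tendsto_sandwich[OF _ _ tendsto_const s_lim]) auto
    then show ?thesis
      using U s_lim by (auto simp: sparse_sets_def)
  qed
  have "random_sparse_reconstruction S V P f" if "sparse_reconstruction S V P f"
  proof -
    from that obtain U where U: "sparse_sets V U" "liminf (\<lambda>n. ereal (clue S (P n) (f n) (U n))) > 0"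
      by (auto simp: sparse_reconstruction_def)
    then have "eventually (\<lambda>n. clue S (P n) (f n) (U n) \<noteq> 0) sequentially"
      unfolding liminf_ereal_pos_iff by (auto elim: eventually_mono)
    then show ?thesis
      using random[OF U(1)] U(2) by (auto simp: random_sparse_reconstruction_def)
  qed
  moreover have "full_random_sparse_reconstruction S V P f" if "full_sparse_reconstruction S V P f"
  proof -
    from that obtain U where U: "sparse_sets V U" "(\<lambda>n. clue S (P n) (f n) (U n)) \<longlonglongrightarrow> 1"
      by (auto simp: full_sparse_reconstruction_def)
    then have "eventually (\<lambda>n. clue S (P n) (f n) (U n) \<noteq> 0) sequentially"
      by (intro tendsto_imp_eventually_ne) auto
    then show ?thesis
      using random[OF U(1)] U(2) by (auto simp: full_random_sparse_reconstruction_def)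
  qed
  moreover have "sparse_reconstruction S V P f" if "random_sparse_reconstruction S V P f"
  proof -
    from that obtain R where R: "sparse_random_sets V P R"
      "liminf (\<lambda>n. ereal (expected_clue S (P n) (f n) (R n))) > 0"
      by (auto simp: random_sparse_reconstruction_def)
    obtain U s where U: "sparse_sets V U" and s: "s \<longlonglongrightarrow> 0"
      and le: "\<And>n. expected_clue S (P n) (f n) (R n) \<le> clue S (P n) (f n) (U n) + s n"
      using deterministic[OF R(1)] by blast
    obtain c where c: "c > 0"
      "eventually (\<lambda>n. c \<le> expected_clue S (P n) (f n) (R n)) sequentially"
      using R(2) unfolding liminf_ereal_pos_iff by auto
    \<comment> \<open>Half of the lower bound \<open>c\<close> absorbs the error
      \<open>s n\<close>.\<close>
    have "eventually (\<lambda>n. s n < c / 2) sequentially"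
      by (rule order_tendstoD(2)[OF s]) (use c(1) in simp)
    with c(2) have "eventually (\<lambda>n. c / 2 \<le> clue S (P n) (f n) (U n)) sequentially"
    proof eventually_elim
      case (elim n)
      then show ?case using le[of n] by linarith
    qed
    then have "liminf (\<lambda>n. ereal (clue S (P n) (f n) (U n))) > 0"
      unfolding liminf_ereal_pos_iff using c(1) by (intro exI[of _ "c / 2"]) auto
    then show ?thesis
      using U by (auto simp: sparse_reconstruction_def)
  qed
  moreover have "full_sparse_reconstruction S V P f" if "full_random_sparse_reconstruction S V P f"
  proof -
    from that obtain R where R: "sparse_random_sets V P R"
      "(\<lambda>n. expected_clue S (P n) (f n) (R n)) \<longlonglongrightarrow> 1"
      by (auto simp: full_random_sparse_reconstruction_def)
    obtain U s where U: "sparse_sets V U" and s: "s \<longlonglongrightarrow> 0"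
      and le: "\<And>n. expected_clue S (P n) (f n) (R n) \<le> clue S (P n) (f n) (U n) + s n"
      using deterministic[OF R(1)] by blast
    have "(\<lambda>n. clue S (P n) (f n) (U n)) \<longlonglongrightarrow> 1"
    \<comment> \<open>The clue is squeezed between the expected clue minus a null error and its
      universal bound 1.\<close>
    proof (rule tendsto_sandwich)
      show "(\<lambda>n. expected_clue S (P n) (f n) (R n) - s n) \<longlonglongrightarrow> 1"
        using tendsto_diff[OF R(2) s] by simp
      show "\<forall>\<^sub>F n in sequentially. expected_clue S (P n) (f n) (R n) - s n \<le> clue S (P n) (f n) (U n)"
        using le by (simp add: algebra_simps)
      show "\<forall>\<^sub>F n in sequentially. clue S (P n) (f n) (U n) \<le> 1"
        using U clue_le by (simp add: sparse_sets_def)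
    qed simp
    then show ?thesis
      using U by (auto simp: full_sparse_reconstruction_def)
  qed
  ultimately show ?thesis by blast
qed

end
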